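(* Let $(X,\rho)$ be a compact metric space. The function $\rho_O\colon O(X)\times O(X)\to\mathbb{R}$ defined by $$\rho_O(\mu_1,\mu_2)=\inf\big\{\max\{\rho(x,y):(x,y)\in\operatorname{supp}\xi\}:\ \xi\in\Lambda(\mu_1,\mu_2)\big\}$$ is a metric on the space $O(X)$ of normed monetary risk measures, and it is an extension of the metric $\rho$ on $X$, i.e. $\rho_O(\delta_x,\delta_y)=\rho(x,y)$ for all $x,y\in X$.
   Context: For a compact Hausdorff space $X$, $C(X)$ is the algebra of continuous functions $X\to\mathbb{R}$ with pointwise order. A normed monetary risk measure on $X$ is a map $\mu\colon C(X)\to\mathbb{R}$ such that: (1) $\varphi\le\psi$ implies $\mu(\varphi)\le\mu(\psi)$; (2) $\mu(\varphi+\alpha)=\mu(\varphi)+\alpha$ for all $\varphi\in C(X)$ and $\alpha\in\mathbb{R}$; (3) $\mu(1_X)=1$. The set of all of them is $O(X)$. For a continuous map $f\colon X\to Y$ of compact Hausdorff spaces, $O(f)\colon O(X)\to O(Y)$ is defined by $O(f)(\mu)(\varphi)=\mu(\varphi\circ f)$, $\varphi\in C(Y)$. For a closed $A\subset X$ with inclusion $i\colon A\to X$, $O(i)$ is an embedding, and $O(A)$ is identified with its image in $O(X)$. One says $\mu\in O(X)$ is concentrated on $A$ if $\mu\in O(A)$; equivalently, $\mu(\varphi)=\mu(\psi)$ whenever $\varphi,\psi\in C(X)$ satisfy $\varphi|_A=\psi|_A$. The support $\operatorname{supp}\mu$ is the smallest closed set on which $\mu$ is concentrated: $\operatorname{supp}\mu=\bigcap\{A: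 A \text{ closed in } X,\ \mu\in O(A)\}$. $\delta_x\in O(X)$ is the Dirac measure, $\delta_x(\varphi)=\varphi(x)$. Let $\pi_1,\pi_2\colon X\times X\to X$ be the coordinate projections. For $\mu_1,\mu_2\in O(X)$, $\Lambda(\mu_1,\mu_2)=O(\pi_1)^{-1}(\mu_1)\cap O(\pi_2)^{-1}(\mu_2)\subset O(X\times X)$ (this set is nonempty); its elements are called $(\mu_1,\mu_2)$-admissible. *)

theory Defs
  imports "HOL-Analysis.Analysis"
begin

text \<open>Spaces are carrier-based (\<open>'a topology\<close>), so that closed subspaces and products are
  again spaces. Functions on a carrier, and functionals on \<open>cont_funs X\<close>, are normalised to
  \<open>undefined\<close> elsewhere; equality of HOL functions is then equality of functions on the
  carrier.\<close>

definition cont_funs :: "'a topology \<Rightarrow> ('a \<Rightarrow> real) set" where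
  "cont_funs X = {\<phi> \<in> extensional (topspace X). continuous_map X euclideanreal \<phi>}"

definition risk_measures :: "'a topology \<Rightarrow> (('a \<Rightarrow> real) \<Rightarrow> real) set" where
  "risk_measures X = {\<mu> \<in> extensional (cont_funs X).
     (\<forall>\<phi>\<in>cont_funs X. \<forall>\<psi>\<in>cont_funs X.
        (\<forall>x\<in>topspace X. \<phi> x \<le> \<psi> x) \<longrightarrow> \<mu> \<phi> \<le> \<mu> \<psi>) \<and>
     (\<forall>\<phi>\<in>cont_funs X. \<forall>\<alpha>. \<mu> (\<lambda>x\<in>topspace X. \<phi> x + \<alpha>) = \<mu> \<phi> + \<alpha>) \<and>
     \<mu> (\<lambda>x\<in>topspace X. 1) = 1}"

definition push_risk ::
  "'a topology \<Rightarrow> 'b topology \<Rightarrow> ('a \<Rightarrow> 'b) \<Rightarrow> (('a \<Rightarrow> real) \<Rightarrow> real) \<Rightarrow> (('b \<Rightarrow> real) \<Rightarrow> real)" where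
  "push_risk X Y f \<mu> = (\<lambda>\<phi>\<in>cont_funs Y. \<mu> (compose (topspace X) \<phi> f))"

text \<open>The set \<open>O(A)\<close> is identified with its image under the map induced by the inclusion
  of \<open>A\<close> in \<open>X\<close>.\<close>

definition concentrated_on :: "'a topology \<Rightarrow> (('a \<Rightarrow> real) \<Rightarrow> real) \<Rightarrow> 'a set \<Rightarrow> bool" where
  "concentrated_on X \<mu> A \<longleftrightarrow>
     \<mu> \<in> push_risk (subtopology X A) X (\<lambda>x. x) ` risk_measures (subtopology X A)"

definition risk_supp :: "'a topology \<Rightarrow> (('a \<Rightarrow> real) \<Rightarrow> real) \<Rightarrow> 'a set" where
  "risk_supp X \<mu> = \<Inter> {A. closedin X A \<and> concentrated_on X \<mu> A}"

definition dirac_risk :: "'a topology \<Rightarrow> 'a \<Rightarrow> (('a \<Rightarrow> real) \<Rightarrow> real)" where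
  "dirac_risk X x = (\<lambda>\<phi>\<in>cont_funs X. \<phi> x)"

definition admissible ::
  "'a topology \<Rightarrow> (('a \<Rightarrow> real) \<Rightarrow> real) \<Rightarrow> (('a \<Rightarrow> real) \<Rightarrow> real) \<Rightarrow> (('a \<times> 'a \<Rightarrow> real) \<Rightarrow> real) set" where
  "admissible X \<mu>1 \<mu>2 = {\<xi> \<in> risk_measures (prod_topology X X).
     push_risk (prod_topology X X) X fst \<xi> = \<mu>1 \<and>
     push_risk (prod_topology X X) X snd \<xi> = \<mu>2}"

text \<open>\<open>GREATEST\<close> is the maximum of the set of distances, which exists because the support is
  nonempty and compact; \<open>Max\<close> would only be meaningful for finite sets. The value 0 outside
  \<open>O(X)\<close> is needed because the locale \<open>Metric_space\<close> demands nonnegativity and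
  symmetry for all arguments, also those outside the carrier.\<close>

definition risk_dist ::
  "'a set \<Rightarrow> ('a \<Rightarrow> 'a \<Rightarrow> real) \<Rightarrow> (('a \<Rightarrow> real) \<Rightarrow> real) \<Rightarrow> (('a \<Rightarrow> real) \<Rightarrow> real) \<Rightarrow> real" where
  "risk_dist M d \<mu>1 \<mu>2 =
     (let X = Metric_space.mtopology M d in
      if \<mu>1 \<in> risk_measures X \<and> \<mu>2 \<in> risk_measures X
      then INF \<xi>\<in>admissible X \<mu>1 \<mu>2.
             GREATEST r. r \<in> (\<lambda>(x, y). d x y) ` risk_supp (prod_topology X X) \<xi>
      else 0)"

end

theory Submission
  imports Defs
begin

text \<open>
  Call \<open>\<mu>\<close> and \<open>\<nu>\<close> \<open>r\<close>-close if \<open>\<mu> f \<le> \<nu> g\<close> and \<open>\<nu> f \<le> \<mu> g\<close> whenever \<open>f x \<le> g y\<close> for all points with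
  \<open>d x y \<le> r\<close>. The distance of \<open>\<mu>\<close> and \<open>\<nu>\<close> is the infimum of all \<open>r \<ge> 0\<close> for which they are \<open>r\<close>-close,
  and the metric axioms are easy to read off from this description, which no longer mentions
  functionals on the square.

  One half of the description says that an admissible \<open>\<xi>\<close> with \<open>d \<le> r\<close> on its support makes its
  marginals \<open>r\<close>-close. If \<open>f x \<le> g y\<close> on the support, then \<open>\<xi>\<close> preserves this inequality, because a
  risk measure only sees the order on its support (\<open>ordered_on_risk_supp\<close>). The other half is a
  Hahn-Banach type argument without linearity: a monotone, translation-equivariant functional
  given on any translation-invariant set of functions that contains the constants extends to all
  continuous functions (\<open>risk_measure_extension\<close>). On the compact set \<open>{d \<le> r}\<close>, \<open>r\<close>-closeness says
  exactly that \<open>\<mu>\<close> on functions of the first coordinate and \<open>\<nu>\<close> on functions of the second one form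
  such a partial functional, so that an admissible functional concentrated on \<open>{d \<le> r}\<close> exists.
  With \<open>r\<close> at least the diameter this also shows that admissible functionals always exist.

  For the triangle inequality one would like to glue an admissible functional for \<open>(\<mu>, \<nu>)\<close> to one
  for \<open>(\<nu>, \<kappa>)\<close> along their supports. For nonlinear functionals this is problematic, since the
  support of \<open>\<nu>\<close> can be strictly smaller than the projection of the support of an admissible
  functional. Closeness avoids the supports: if \<open>f x \<le> h z\<close> whenever \<open>d x z \<le> a + b + e\<close>, a Lipschitz
  function \<open>g\<close> separates \<open>f\<close> from \<open>h\<close>, in the sense that \<open>f x \<le> g y\<close> for \<open>d x y \<le> a\<close> and \<open>g y \<le> h z\<close> for
  \<open>d y z \<le> b\<close>, whence \<open>\<mu> f \<le> \<nu> g \<le> \<kappa> h\<close> (\<open>close_trans\<close>). Measures at distance 0 agree by uniform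
  continuity, and Dirac measures at \<open>x\<close> and \<open>y\<close> are \<open>r\<close>-close exactly if \<open>d x y \<le> r\<close>.
\<close>

section \<open>Continuous functions and risk measures\<close>

lemma restrict_in_cont_funs:
  "continuous_map X euclideanreal f \<Longrightarrow> (\<lambda>x\<in>topspace X. f x) \<in> cont_funs X"
  by (auto simp: cont_funs_def intro: continuous_map_eq)

lemma cont_funs_continuous: "f \<in> cont_funs X \<Longrightarrow> continuous_map X euclideanreal f"
  by (simp add: cont_funs_def)

lemma cont_funs_eqI:
  "\<lbrakk>f \<in> cont_funs X; g \<in> cont_funs X; \<And>x. x \<in> topspace X \<Longrightarrow> f x = g x\<rbrakk> \<Longrightarrow> f = g"
  unfolding cont_funs_def by (blast intro: extensionalityI)

lemma const_in_cont_funs: "(\<lambda>x\<in>topspace X. c) \<in> cont_funs X"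
  by (intro restrict_in_cont_funs) auto

lemma shift_in_cont_funs: "\<phi> \<in> cont_funs X \<Longrightarrow> (\<lambda>x\<in>topspace X. \<phi> x + c) \<in> cont_funs X"
  by (intro restrict_in_cont_funs continuous_map_add) (auto dest: cont_funs_continuous)

lemma compose_in_cont_funs:
  assumes "continuous_map X Y f" "\<phi> \<in> cont_funs Y"
  shows "compose (topspace X) \<phi> f \<in> cont_funs X"
  using continuous_map_compose[OF assms(1) cont_funs_continuous[OF assms(2)]]
  unfolding compose_def o_def by (rule restrict_in_cont_funs)

lemma cont_funs_bounded:
  assumes "compact_space X" "\<phi> \<in> cont_funs X"
  obtains c where "\<And>x. x \<in> topspace X \<Longrightarrow> \<bar>\<phi> x\<bar> \<le> c"
proof -
  have "compactin euclideanreal (\<phi> ` topspace X)"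
    using assms by (metis cont_funs_continuous compact_space_def image_compactin)
  then have "bounded (\<phi> ` topspace X)"
    by (simp add: compact_imp_bounded)
  then show thesis
    using that by (auto simp: bounded_iff)
qed

lemma risk_measure_mono:
  "\<lbrakk>\<mu> \<in> risk_measures X; \<phi> \<in> cont_funs X; \<psi> \<in> cont_funs X; \<And>x. x \<in> topspace X \<Longrightarrow> \<phi> x \<le> \<psi> x\<rbrakk>
    \<Longrightarrow> \<mu> \<phi> \<le> \<mu> \<psi>"
  by (simp add: risk_measures_def)

lemma risk_measure_shift:
  "\<lbrakk>\<mu> \<in> risk_measures X; \<phi> \<in> cont_funs X\<rbrakk> \<Longrightarrow> \<mu> (\<lambda>x\<in>topspace X. \<phi> x + c) = \<mu> \<phi> + c"
  by (simp add: risk_measures_def)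

lemma risk_measure_const:
  assumes "\<mu> \<in> risk_measures X"
  shows "\<mu> (\<lambda>x\<in>topspace X. c) = c"
proof -
  have "(\<lambda>x\<in>topspace X. c) = (\<lambda>x\<in>topspace X. (\<lambda>x\<in>topspace X. 1) x + (c - 1))"
    by (auto simp: restrict_def)
  moreover have "\<mu> (\<lambda>x\<in>topspace X. 1) = 1"
    using assms by (simp add: risk_measures_def)
  ultimately show ?thesis
    using risk_measure_shift[OF assms const_in_cont_funs, of 1 "c - 1"] by simp
qed

lemma risk_measure_eqI:
  assumes "\<mu> \<in> risk_measures X" "\<nu> \<in> risk_measures X" "\<And>\<phi>. \<phi> \<in> cont_funs X \<Longrightarrow> \<mu> \<phi> = \<nu> \<phi>"
  shows "\<mu> = \<nu>"
  using assms unfolding risk_measures_def by (blast intro: extensionalityI)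

lemma push_risk_in_risk_measures:
  assumes "continuous_map X Y f" "\<mu> \<in> risk_measures X"
  shows "push_risk X Y f \<mu> \<in> risk_measures Y"
proof -
  have im: "f x \<in> topspace Y" if "x \<in> topspace X" for x
    using assms(1) that by (meson continuous_map_image_subset_topspace image_subset_iff)
  have "compose (topspace X) (\<lambda>y\<in>topspace Y. \<phi> y + c) f = (\<lambda>x\<in>topspace X. compose (topspace X) \<phi> f x + c)"
    for \<phi> :: "'b \<Rightarrow> real" and c
    using im by (auto simp: compose_def restrict_def)
  moreover have "compose (topspace X) (\<lambda>y\<in>topspace Y. 1) f = (\<lambda>x\<in>topspace X. 1 :: real)"
    using im by (auto simp: compose_def restrict_def)
  ultimately show ?thesis
    unfolding risk_measures_def push_risk_def
    using assms im
    by (auto simp: shift_in_cont_funs const_in_cont_funs risk_measure_shift risk_measure_const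
        compose_in_cont_funs compose_eq intro!: risk_measure_mono[OF assms(2)])
qed

lemma push_risk_push_risk:
  assumes "continuous_map X Y f" "continuous_map Y Z g"
  shows "push_risk Y Z g (push_risk X Y f \<mu>) = push_risk X Z (\<lambda>x. g (f x)) \<mu>"
proof
  fix \<phi> :: "'c \<Rightarrow> real"
  have "compose (topspace X) (compose (topspace Y) \<phi> g) f = compose (topspace X) \<phi> (\<lambda>x. g (f x))"
    using continuous_map_image_subset_topspace[OF assms(1)]
    by (auto simp: compose_def restrict_def fun_eq_iff)
  then show "push_risk Y Z g (push_risk X Y f \<mu>) \<phi> = push_risk X Z (\<lambda>x. g (f x)) \<mu> \<phi>"
    using assms by (simp add: push_risk_def compose_in_cont_funs)
qed

lemma dirac_risk_in_risk_measures:
  "x \<in> topspace X \<Longrightarrow> dirac_risk X x \<in> risk_measures X"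
  by (auto simp: dirac_risk_def risk_measures_def shift_in_cont_funs const_in_cont_funs)

section \<open>Supports\<close>

text \<open>The intrinsic form of being concentrated on \<open>A\<close>. With inequalities in place of
  equalities it passes to intersections by inserting functions between \<open>\<phi>\<close> and \<open>\<psi>\<close>.\<close>

definition ordered_on :: "'a topology \<Rightarrow> (('a \<Rightarrow> real) \<Rightarrow> real) \<Rightarrow> 'a set \<Rightarrow> bool" where
  "ordered_on X \<mu> A \<longleftrightarrow>
     (\<forall>\<phi>\<in>cont_funs X. \<forall>\<psi>\<in>cont_funs X. (\<forall>x\<in>A. \<phi> x \<le> \<psi> x) \<longrightarrow> \<mu> \<phi> \<le> \<mu> \<psi>)"

lemma ordered_onD:
  "\<lbrakk>ordered_on X \<mu> A; \<phi> \<in> cont_funs X; \<psi> \<in> cont_funs X; \<And>x. x \<in> A \<Longrightarrow> \<phi> x \<le> \<psi> x\<rbrakk> \<Longrightarrow> \<mu> \<phi> \<le> \<mu> \<psi>"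
  by (simp add: ordered_on_def)

lemma concentrated_on_imp_ordered_on:
  assumes "concentrated_on X \<mu> A"
  shows "ordered_on X \<mu> A"
proof -
  obtain \<nu> where \<nu>: "\<nu> \<in> risk_measures (subtopology X A)"
    and \<mu>: "\<mu> = push_risk (subtopology X A) X (\<lambda>x. x) \<nu>"
    using assms by (auto simp: concentrated_on_def)
  have id: "continuous_map (subtopology X A) X (\<lambda>x. x)"
    by simp
  show ?thesis
    unfolding ordered_on_def \<mu>
    using compose_in_cont_funs[OF id]
    by (auto simp: push_risk_def compose_eq intro!: risk_measure_mono[OF \<nu>])
qed

lemma concentrated_on_topspace:
  assumes "\<mu> \<in> risk_measures X"
  shows "concentrated_on X \<mu> (topspace X)"
proof -
  have "push_risk X X (\<lambda>x. x) \<mu> = \<mu>"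
  proof (rule risk_measure_eqI[OF push_risk_in_risk_measures assms])
    fix \<phi> assume "\<phi> \<in> cont_funs X"
    moreover from this have "compose (topspace X) \<phi> (\<lambda>x. x) = \<phi>"
      by (intro cont_funs_eqI[OF compose_in_cont_funs]) (auto simp: compose_eq)
    ultimately show "push_risk X X (\<lambda>x. x) \<mu> \<phi> = \<mu> \<phi>"
      by (simp add: push_risk_def)
  qed (use assms in auto)
  then show ?thesis
    using assms unfolding concentrated_on_def by (metis image_eqI subtopology_topspace)
qed

text \<open>Given \<open>\<phi> \<le> \<psi>\<close> on \<open>A \<inter> B\<close>, it suffices to find \<open>\<theta>\<close> with \<open>\<phi> \<le> \<theta>\<close> on \<open>A\<close> and \<open>\<theta> \<le> \<psi> + e\<close> on \<open>B\<close>. The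
  part of \<open>A\<close> where \<open>\<phi> \<ge> \<psi> + e\<close> is disjoint from \<open>B\<close>, so a Urysohn function can switch between the
  two requirements.\<close>

lemma ordered_on_Int:
  assumes X: "normal_space X" and \<mu>: "\<mu> \<in> risk_measures X"
    and A: "closedin X A" "ordered_on X \<mu> A" and B: "closedin X B" "ordered_on X \<mu> B"
  shows "ordered_on X \<mu> (A \<inter> B)"
  unfolding ordered_on_def
proof (intro ballI impI)
  fix \<phi> \<psi>
  assume \<phi>: "\<phi> \<in> cont_funs X" and \<psi>: "\<psi> \<in> cont_funs X" and le: "\<forall>x\<in>A \<inter> B. \<phi> x \<le> \<psi> x"
  note cont = cont_funs_continuous[OF \<phi>] cont_funs_continuous[OF \<psi>]
  show "\<mu> \<phi> \<le> \<mu> \<psi>"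
  proof (rule field_le_epsilon)
    fix e :: real assume e: "e > 0"
    let ?P = "{x \<in> topspace X. \<phi> x - \<psi> x \<in> {e..}}"
    have "closedin X ?P"
      by (rule closedin_continuous_map_preimage[of _ euclideanreal])
        (auto intro!: continuous_map_diff cont)
    then have "closedin X (A \<inter> ?P)"
      using A by blast
    moreover have "disjnt B (A \<inter> ?P)"
      using le e by (force simp: disjnt_def)
    ultimately obtain w where w: "continuous_map X (top_of_set {0..1::real}) w"
      "w ` B \<subseteq> {0}" "w ` (A \<inter> ?P) \<subseteq> {1}"
      using Urysohn_lemma[OF X B(1), of "A \<inter> ?P" 0 1] by auto
    define \<theta> where "\<theta> = (\<lambda>x\<in>topspace X. \<psi> x + e + w x * max 0 (\<phi> x - \<psi> x))"
    have \<theta>: "\<theta> \<in> cont_funs X"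
      unfolding \<theta>_def using w(1)
      by (intro restrict_in_cont_funs continuous_map_add continuous_map_real_mult
          continuous_map_real_max continuous_map_diff cont)
        (auto simp: continuous_map_in_subtopology)
    have "\<mu> \<phi> \<le> \<mu> \<theta>"
    proof (rule ordered_onD[OF A(2) \<phi> \<theta>])
      fix x assume x: "x \<in> A"
      then have xX: "x \<in> topspace X"
        using A(1) closedin_subset by blast
      show "\<phi> x \<le> \<theta> x"
      proof (cases "x \<in> ?P")
        case True
        then have "w x = 1"
          using w(3) x by blast
        then show ?thesis
          using e xX by (simp add: \<theta>_def)
      next
        case False
        have "0 \<le> w x * max 0 (\<phi> x - \<psi> x)"
          using w(1) xX by (intro mult_nonneg_nonneg) (auto simp: continuous_map_def)
        then show ?thesis
          using False xX by (simp add: \<theta>_def)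
      qed
    qed
    also have "\<mu> \<theta> \<le> \<mu> (\<lambda>x\<in>topspace X. \<psi> x + e)"
    proof (rule ordered_onD[OF B(2) \<theta> shift_in_cont_funs[OF \<psi>]])
      fix x assume x: "x \<in> B"
      then have "x \<in> topspace X" "w x = 0"
        using B(1) closedin_subset w(2) by blast+
      then show "\<theta> x \<le> (\<lambda>x\<in>topspace X. \<psi> x + e) x"
        by (simp add: \<theta>_def)
    qed
    also have "\<dots> = \<mu> \<psi> + e"
      using risk_measure_shift[OF \<mu> \<psi>] .
    finally show "\<mu> \<phi> \<le> \<mu> \<psi> + e" .
  qed
qed

text \<open>If \<open>\<phi> \<le> \<psi>\<close> on the whole intersection, then by compactness \<open>\<phi> < \<psi> + e\<close> already on a finite
  one.\<close>

lemma ordered_on_Inter: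
  assumes X: "compact_space X" "normal_space X" and \<mu>: "\<mu> \<in> risk_measures X"
    and \<A>: "\<A> \<noteq> {}" "\<And>A. A \<in> \<A> \<Longrightarrow> closedin X A \<and> ordered_on X \<mu> A"
  shows "ordered_on X \<mu> (\<Inter>\<A>)"
  unfolding ordered_on_def
proof (intro ballI impI)
  fix \<phi> \<psi>
  assume \<phi>: "\<phi> \<in> cont_funs X" and \<psi>: "\<psi> \<in> cont_funs X" and le: "\<forall>x\<in>\<Inter>\<A>. \<phi> x \<le> \<psi> x"
  note cont = cont_funs_continuous[OF \<phi>] cont_funs_continuous[OF \<psi>]
  show "\<mu> \<phi> \<le> \<mu> \<psi>"
  proof (rule field_le_epsilon)
    fix e :: real assume e: "e > 0"
    let ?P = "{x \<in> topspace X. \<phi> x - \<psi> x \<in> {e..}}"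
    have P: "closedin X ?P"
      by (rule closedin_continuous_map_preimage[of _ euclideanreal])
        (auto intro!: continuous_map_diff cont)
    have "compactin X ?P"
      by (rule closedin_compact_space[OF X(1) P])
    moreover have "?P \<inter> \<Inter>\<A> = {}"
      using le e by force
    moreover have "\<forall>A\<in>\<A>. closedin X A"
      using \<A>(2) by blast
    ultimately obtain \<F> where \<F>: "finite \<F>" "\<F> \<subseteq> \<A>" "?P \<inter> \<Inter>\<F> = {}"
      unfolding compactin_fip by meson
    \<comment> \<open>\<open>\<F>\<close> may be empty, and then its intersection is all of the type; \<open>A0\<close> keeps the sets inside \<open>X\<close>.\<close>
    obtain A0 where A0: "A0 \<in> \<A>"
      using \<A>(1) by blast
    have "closedin X (A0 \<inter> \<Inter>\<F>) \<and> ordered_on X \<mu> (A0 \<inter> \<Inter>\<F>)"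
      using \<F>(1,2)
    proof (induction rule: finite_induct)
      case empty
      then show ?case
        using \<A>(2)[OF A0] by simp
    next
      case (insert A \<F>)
      have *: "A0 \<inter> \<Inter>(insert A \<F>) = (A0 \<inter> \<Inter>\<F>) \<inter> A"
        by auto
      have A: "closedin X A" "ordered_on X \<mu> A" and "closedin X (A0 \<inter> \<Inter>\<F>)" "ordered_on X \<mu> (A0 \<inter> \<Inter>\<F>)"
        using insert \<A>(2)[of A] by auto
      then show ?case
        unfolding * using ordered_on_Int[OF X(2) \<mu>] closedin_Int by metis
    qed
    then have "ordered_on X \<mu> (A0 \<inter> \<Inter>\<F>)" ..
    then have "\<mu> \<phi> \<le> \<mu> (\<lambda>x\<in>topspace X. \<psi> x + e)"
    proof (rule ordered_onD[OF _ \<phi> shift_in_cont_funs[OF \<psi>]])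
      fix x assume "x \<in> A0 \<inter> \<Inter>\<F>"
      moreover from this have "x \<in> topspace X"
        using \<A>(2)[OF A0] closedin_subset by blast
      ultimately show "\<phi> x \<le> (\<lambda>x\<in>topspace X. \<psi> x + e) x"
        using \<F>(3) by fastforce
    qed
    then show "\<mu> \<phi> \<le> \<mu> \<psi> + e"
      using risk_measure_shift[OF \<mu> \<psi>] by simp
  qed
qed

lemma ordered_on_risk_supp:
  assumes "compact_space X" "normal_space X" "\<mu> \<in> risk_measures X"
  shows "ordered_on X \<mu> (risk_supp X \<mu>)"
  unfolding risk_supp_def using concentrated_on_topspace[OF assms(3)]
  by (intro ordered_on_Inter assms) (auto intro: concentrated_on_imp_ordered_on)

lemma closedin_risk_supp:
  assumes "\<mu> \<in> risk_measures X"
  shows "closedin X (risk_supp X \<mu>)"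
  unfolding risk_supp_def using concentrated_on_topspace[OF assms] by (intro closedin_Inter) auto

lemma risk_supp_nonempty:
  assumes "compact_space X" "normal_space X" "\<mu> \<in> risk_measures X"
  shows "risk_supp X \<mu> \<noteq> {}"
proof
  assume "risk_supp X \<mu> = {}"
  then have "\<mu> (\<lambda>x\<in>topspace X. 1) \<le> \<mu> (\<lambda>x\<in>topspace X. 0)"
    by (intro ordered_onD[OF ordered_on_risk_supp[OF assms]] const_in_cont_funs) auto
  then show False
    by (simp add: risk_measure_const[OF assms(3)])
qed

section \<open>Extension of partial functionals and couplings\<close>

text \<open>The partial functional is given by its graph \<open>L\<close>, because it will be pieced together from
  two marginals, for which single-valuedness is a consequence of monotonicity. The extension is the
  least possible one: \<open>\<phi>\<close> is sent to the supremum of the values on \<open>L\<close> below \<open>\<phi>\<close>.\<close>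

lemma risk_measure_extension:
  fixes Z :: "'a topology" and L :: "(('a \<Rightarrow> real) \<times> real) set"
  assumes Z: "compact_space Z"
    and L: "\<And>\<phi> a. (\<phi>, a) \<in> L \<Longrightarrow> \<phi> \<in> cont_funs Z"
    and zero: "(\<lambda>x\<in>topspace Z. 0, 0) \<in> L"
    and shift: "\<And>\<phi> a c. (\<phi>, a) \<in> L \<Longrightarrow> (\<lambda>x\<in>topspace Z. \<phi> x + c, a + c) \<in> L"
    and mono: "\<And>\<phi> \<psi> a b. \<lbrakk>(\<phi>, a) \<in> L; (\<psi>, b) \<in> L; \<And>x. x \<in> topspace Z \<Longrightarrow> \<phi> x \<le> \<psi> x\<rbrakk> \<Longrightarrow> a \<le> b"
  obtains \<xi> where "\<xi> \<in> risk_measures Z" "\<And>\<phi> a. (\<phi>, a) \<in> L \<Longrightarrow> \<xi> \<phi> = a"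
proof -
  define S where "S \<phi> = {a. \<exists>\<psi>. (\<psi>, a) \<in> L \<and> (\<forall>x\<in>topspace Z. \<psi> x \<le> \<phi> x)}" for \<phi> :: "'a \<Rightarrow> real"
  define \<xi> where "\<xi> = (\<lambda>\<phi>\<in>cont_funs Z. Sup (S \<phi>))"
  have const: "(\<lambda>x\<in>topspace Z. c, c) \<in> L" for c
  proof -
    have "(\<lambda>x\<in>topspace Z. (\<lambda>x\<in>topspace Z. 0) x + c) = (\<lambda>x\<in>topspace Z. c)"
      by (auto simp: restrict_def)
    then show ?thesis
      using shift[OF zero, of c] by simp
  qed
  have S: "S \<phi> \<noteq> {}" "bdd_above (S \<phi>)" if \<phi>: "\<phi> \<in> cont_funs Z" for \<phi>
  proof -
    obtain c where c: "\<And>x. x \<in> topspace Z \<Longrightarrow> \<bar>\<phi> x\<bar> \<le> c"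
      using cont_funs_bounded[OF Z \<phi>] by blast
    have "-c \<in> S \<phi>"
      unfolding S_def using const[of "-c"] c by (force simp: abs_le_iff)
    then show "S \<phi> \<noteq> {}"
      by blast
    have "a \<le> c" if "a \<in> S \<phi>" for a
      using that c unfolding S_def by (fastforce intro: mono[OF _ const] simp: abs_le_iff)
    then show "bdd_above (S \<phi>)"
      by (auto simp: bdd_above_def)
  qed
  have le: "Sup (S \<phi>) + c \<le> Sup (S \<psi>)"
    if \<phi>: "\<phi> \<in> cont_funs Z" and \<psi>: "\<psi> \<in> cont_funs Z" and \<phi>\<psi>: "\<And>x. x \<in> topspace Z \<Longrightarrow> \<phi> x + c \<le> \<psi> x"
    for \<phi> \<psi> c
  proof -
    have "a \<le> Sup (S \<psi>) - c" if a: "a \<in> S \<phi>" for a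
    proof -
      obtain \<theta> where "(\<theta>, a) \<in> L" "\<forall>x\<in>topspace Z. \<theta> x \<le> \<phi> x"
        using a by (auto simp: S_def)
      then have "a + c \<in> S \<psi>"
        unfolding S_def using shift[of \<theta> a c] \<phi>\<psi>
        by (force intro: order_trans[OF add_right_mono])
      then show ?thesis
        using cSup_upper[OF _ S(2)[OF \<psi>]] by (simp add: le_diff_eq)
    qed
    then show ?thesis
      using cSup_least[OF S(1)[OF \<phi>], of "Sup (S \<psi>) - c"] by (simp add: le_diff_eq)
  qed
  have val: "\<xi> \<phi> = a" if "(\<phi>, a) \<in> L" for \<phi> a
  proof -
    have "Sup (S \<phi>) = a"
    proof (rule cSup_eq_maximum)
      show "a \<in> S \<phi>"
        using that by (auto simp: S_def)
      show "b \<le> a" if "b \<in> S \<phi>" for b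
        using that \<open>(\<phi>, a) \<in> L\<close> by (auto simp: S_def intro: mono)
    qed
    then show ?thesis
      using L[OF that] by (simp add: \<xi>_def)
  qed
  have "\<xi> \<in> risk_measures Z"
    unfolding risk_measures_def
  proof (intro CollectI conjI ballI allI impI)
    show "\<xi> \<in> extensional (cont_funs Z)"
      by (simp add: \<xi>_def)
    show "\<xi> (\<lambda>x\<in>topspace Z. 1) = 1"
      using val[OF const] .
    fix \<phi> assume \<phi>: "\<phi> \<in> cont_funs Z"
    show "\<xi> \<phi> \<le> \<xi> \<psi>" if "\<psi> \<in> cont_funs Z" "\<forall>x\<in>topspace Z. \<phi> x \<le> \<psi> x" for \<psi>
      using le[OF \<phi> that(1), of 0] \<phi> that by (simp add: \<xi>_def)
    show "\<xi> (\<lambda>x\<in>topspace Z. \<phi> x + c) = \<xi> \<phi> + c" for c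
      using le[OF \<phi> shift_in_cont_funs[OF \<phi>], of c c] le[OF shift_in_cont_funs[OF \<phi>] \<phi>, of c "-c"]
        \<phi> shift_in_cont_funs[OF \<phi>, of c]
      by (simp add: \<xi>_def)
  qed
  then show thesis
    using val that by blast
qed

text \<open>The two compatibility conditions are clearly necessary; together with surjectivity of the
  projections, which gives monotonicity within each marginal, they say that the two marginals form
  a monotone partial functional on \<open>Z\<close>.\<close>

lemma coupling_exists:
  assumes Z: "compact_space Z"
    and p: "continuous_map Z X p" "p ` topspace Z = topspace X"
    and q: "continuous_map Z Y q" "q ` topspace Z = topspace Y"
    and \<mu>: "\<mu> \<in> risk_measures X" and \<nu>: "\<nu> \<in> risk_measures Y"
    and \<mu>\<nu>: "\<And>f g. \<lbrakk>f \<in> cont_funs X; g \<in> cont_funs Y; \<And>z. z \<in> topspace Z \<Longrightarrow> f (p z) \<le> g (q z)\<rbrakk> \<Longrightarrow> \<mu> f \<le> \<nu> g"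
    and \<nu>\<mu>: "\<And>f g. \<lbrakk>f \<in> cont_funs X; g \<in> cont_funs Y; \<And>z. z \<in> topspace Z \<Longrightarrow> g (q z) \<le> f (p z)\<rbrakk> \<Longrightarrow> \<nu> g \<le> \<mu> f"
  obtains \<xi> where "\<xi> \<in> risk_measures Z" "push_risk Z X p \<xi> = \<mu>" "push_risk Z Y q \<xi> = \<nu>"
proof -
  let ?p = "\<lambda>f. compose (topspace Z) f p" and ?q = "\<lambda>g. compose (topspace Z) g q"
  define L where "L = (\<lambda>f. (?p f, \<mu> f)) ` cont_funs X \<union> (\<lambda>g. (?q g, \<nu> g)) ` cont_funs Y"
  have pX: "p z \<in> topspace X" and qY: "q z \<in> topspace Y" if "z \<in> topspace Z" for z
    using that p(2) q(2) by blast+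
  have shift: "?p (\<lambda>x\<in>topspace X. f x + c) = (\<lambda>z\<in>topspace Z. ?p f z + c)"
    "?q (\<lambda>y\<in>topspace Y. g y + c) = (\<lambda>z\<in>topspace Z. ?q g z + c)" for f :: "_ \<Rightarrow> real" and g :: "_ \<Rightarrow> real" and c
    using pX qY by (auto simp: compose_def restrict_def fun_eq_iff)
  obtain \<xi> where \<xi>: "\<xi> \<in> risk_measures Z" "\<And>\<phi> a. (\<phi>, a) \<in> L \<Longrightarrow> \<xi> \<phi> = a"
  proof (rule risk_measure_extension[OF Z, of L])
    show "\<phi> \<in> cont_funs Z" if "(\<phi>, a) \<in> L" for \<phi> a
      using that p q by (auto simp: L_def compose_in_cont_funs)
    have "?p (\<lambda>x\<in>topspace X. 0 :: real) = (\<lambda>z\<in>topspace Z. 0)"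
      using pX by (auto simp: compose_def restrict_def)
    then have "(\<lambda>z\<in>topspace Z. 0, 0) = (?p (\<lambda>x\<in>topspace X. 0 :: real), \<mu> (\<lambda>x\<in>topspace X. 0))"
      unfolding risk_measure_const[OF \<mu>] by simp
    then show "(\<lambda>z\<in>topspace Z. 0, 0) \<in> L"
      unfolding L_def by (intro UnI1) (rule image_eqI[OF _ const_in_cont_funs])
    show "(\<lambda>z\<in>topspace Z. \<phi> z + c, a + c) \<in> L" if "(\<phi>, a) \<in> L" for \<phi> a c
    proof -
      consider f where "f \<in> cont_funs X" "\<phi> = ?p f" "a = \<mu> f" | g where "g \<in> cont_funs Y" "\<phi> = ?q g" "a = \<nu> g"
        using \<open>(\<phi>, a) \<in> L\<close> by (auto simp: L_def)
      then show ?thesis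
      proof cases
        case 1
        then have "(\<lambda>z\<in>topspace Z. \<phi> z + c, a + c)
            = (?p (\<lambda>x\<in>topspace X. f x + c), \<mu> (\<lambda>x\<in>topspace X. f x + c))"
          by (simp only: shift risk_measure_shift[OF \<mu>])
        then show ?thesis
          unfolding L_def by (intro UnI1) (rule image_eqI[OF _ shift_in_cont_funs[OF 1(1)]])
      next
        case 2
        then have "(\<lambda>z\<in>topspace Z. \<phi> z + c, a + c)
            = (?q (\<lambda>y\<in>topspace Y. g y + c), \<nu> (\<lambda>y\<in>topspace Y. g y + c))"
          by (simp only: shift risk_measure_shift[OF \<nu>])
        then show ?thesis
          unfolding L_def by (intro UnI2) (rule image_eqI[OF _ shift_in_cont_funs[OF 2(1)]])
      qed
    qed
    show "a \<le> b" if "(\<phi>, a) \<in> L" "(\<psi>, b) \<in> L" and le: "\<And>z. z \<in> topspace Z \<Longrightarrow> \<phi> z \<le> \<psi> z" for \<phi> \<psi> a b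
    proof -
      have pp: "\<mu> f \<le> \<mu> f'" if "f \<in> cont_funs X" "f' \<in> cont_funs X" "\<And>z. z \<in> topspace Z \<Longrightarrow> ?p f z \<le> ?p f' z"
        for f f'
      proof (rule risk_measure_mono[OF \<mu> that(1,2)])
        fix x assume "x \<in> topspace X"
        then obtain z where "z \<in> topspace Z" "x = p z"
          using p(2) by blast
        then show "f x \<le> f' x"
          using that(3)[of z] by (simp add: compose_eq)
      qed
      have qq: "\<nu> g \<le> \<nu> g'" if "g \<in> cont_funs Y" "g' \<in> cont_funs Y" "\<And>z. z \<in> topspace Z \<Longrightarrow> ?q g z \<le> ?q g' z"
        for g g'
      proof (rule risk_measure_mono[OF \<nu> that(1,2)])
        fix y assume "y \<in> topspace Y"
        then obtain z where "z \<in> topspace Z" "y = q z"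
          using q(2) by blast
        then show "g y \<le> g' y"
          using that(3)[of z] by (simp add: compose_eq)
      qed
      have pq: "\<mu> f \<le> \<nu> g" if "f \<in> cont_funs X" "g \<in> cont_funs Y" "\<And>z. z \<in> topspace Z \<Longrightarrow> ?p f z \<le> ?q g z"
        for f g
        by (rule \<mu>\<nu>[OF that(1,2)]) (use that(3) in \<open>simp add: compose_eq\<close>)
      have qp: "\<nu> g \<le> \<mu> f" if "f \<in> cont_funs X" "g \<in> cont_funs Y" "\<And>z. z \<in> topspace Z \<Longrightarrow> ?q g z \<le> ?p f z"
        for f g
        by (rule \<nu>\<mu>[OF that(1,2)]) (use that(3) in \<open>simp add: compose_eq\<close>)
      show ?thesis
        using that(1,2) le pp qq pq qp unfolding L_def by blast
    qed
  qed blast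
  have "push_risk Z X p \<xi> = \<mu>"
    by (rule risk_measure_eqI[OF push_risk_in_risk_measures[OF p(1) \<xi>(1)] \<mu>])
      (simp add: push_risk_def \<xi>(2) L_def)
  moreover have "push_risk Z Y q \<xi> = \<nu>"
    by (rule risk_measure_eqI[OF push_risk_in_risk_measures[OF q(1) \<xi>(1)] \<nu>])
      (simp add: push_risk_def \<xi>(2) L_def)
  ultimately show thesis
    using that \<xi>(1) by blast
qed

section \<open>Closeness of risk measures on a compact metric space\<close>

context Metric_space
begin

text \<open>This is only one half of \<open>r\<close>-closeness; the other half is the same relation with the measures
  exchanged. Both halves then compose without reference to each other.\<close>

definition close :: "real \<Rightarrow> (('a \<Rightarrow> real) \<Rightarrow> real) \<Rightarrow> (('a \<Rightarrow> real) \<Rightarrow> real) \<Rightarrow> bool" where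
  "close r \<mu> \<nu> \<longleftrightarrow> (\<forall>f\<in>cont_funs mtopology. \<forall>g\<in>cont_funs mtopology.
     (\<forall>x\<in>M. \<forall>y\<in>M. d x y \<le> r \<longrightarrow> f x \<le> g y) \<longrightarrow> \<mu> f \<le> \<nu> g)"

lemma closeD:
  "\<lbrakk>close r \<mu> \<nu>; f \<in> cont_funs mtopology; g \<in> cont_funs mtopology;
    \<And>x y. \<lbrakk>x \<in> M; y \<in> M; d x y \<le> r\<rbrakk> \<Longrightarrow> f x \<le> g y\<rbrakk> \<Longrightarrow> \<mu> f \<le> \<nu> g"
  by (simp add: close_def)

lemma close_mono: "\<lbrakk>close r \<mu> \<nu>; r \<le> s\<rbrakk> \<Longrightarrow> close s \<mu> \<nu>"
  unfolding close_def by (meson order_trans)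

lemma close_refl: "\<mu> \<in> risk_measures mtopology \<Longrightarrow> 0 \<le> r \<Longrightarrow> close r \<mu> \<mu>"
  unfolding close_def by (auto intro!: risk_measure_mono[of \<mu> mtopology])

lemma Lipschitz_in_cont_funs:
  fixes g :: "'a \<Rightarrow> real"
  assumes "\<And>x y. \<lbrakk>x \<in> M; y \<in> M\<rbrakk> \<Longrightarrow> g x \<le> g y + K * d x y"
  shows "(\<lambda>x\<in>M. g x) \<in> cont_funs mtopology"
proof -
  have "\<bar>g x - g y\<bar> \<le> K * d x y" if "x \<in> M" "y \<in> M" for x y
    using assms[OF that] assms[OF that(2,1)] by (simp add: commute abs_le_iff)
  then have "Lipschitz_continuous_map (metric (M, d)) euclidean_metric g"
    by (auto simp: Lipschitz_continuous_map_def dist_real_def)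
  then have "continuous_map mtopology euclideanreal g"
    using Lipschitz_continuous_imp_continuous_map by fastforce
  then show ?thesis
    using restrict_in_cont_funs by fastforce
qed

text \<open>The separating function \<open>g y\<close> is the supremum of \<open>f x - K * max 0 (d x y - a)\<close>, that is, of
  \<open>f\<close> over the ball of radius \<open>a\<close> around \<open>y\<close>, with points outside penalised so that \<open>g\<close> becomes
  continuous. The slack \<open>e\<close> leaves room for the points between radius \<open>a\<close> and \<open>a + e\<close>, at which the
  penalty is not yet effective.\<close>

lemma close_trans:
  assumes comp: "compact_space mtopology" and ab: "0 \<le> a" "0 \<le> b" "0 < e"
    and \<mu>\<nu>: "close a \<mu> \<nu>" and \<nu>\<kappa>: "close b \<nu> \<kappa>"
  shows "close (a + b + e) \<mu> \<kappa>"
  unfolding close_def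
proof (intro ballI impI)
  fix f h
  assume f: "f \<in> cont_funs mtopology" and h: "h \<in> cont_funs mtopology"
    and le: "\<forall>x\<in>M. \<forall>z\<in>M. d x z \<le> a + b + e \<longrightarrow> f x \<le> h z"
  obtain B where B: "\<And>x. x \<in> M \<Longrightarrow> \<bar>f x\<bar> \<le> B"
    using cont_funs_bounded[OF comp f] by auto
  obtain C where C: "\<And>x. x \<in> M \<Longrightarrow> \<bar>h x\<bar> \<le> C"
    using cont_funs_bounded[OF comp h] by auto
  \<comment> \<open>With this slope, no value of \<open>f\<close> minus the penalty at distance \<open>a + e\<close> exceeds a value of \<open>h\<close>.\<close>
  define K where "K = (\<bar>B\<bar> + \<bar>C\<bar>) / e"
  have K: "0 \<le> K" "K * e = \<bar>B\<bar> + \<bar>C\<bar>"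
    using ab by (auto simp: K_def)
  define u where "u y x = f x - K * max 0 (d x y - a)" for x y
  define g where "g y = (SUP x\<in>M. u y x)" for y
  have bdd: "bdd_above (u y ` M)" for y
  proof (rule bdd_aboveI2)
    show "u y x \<le> B" if "x \<in> M" for x
      using B[OF that] mult_nonneg_nonneg[OF K(1), of "max 0 (d x y - a)"] by (simp add: u_def)
  qed
  have g_le: "g y \<le> c" if "y \<in> M" "\<And>x. x \<in> M \<Longrightarrow> u y x \<le> c" for y c
    unfolding g_def using that by (intro cSUP_least) auto
  have u_le: "u y x \<le> g y" if "x \<in> M" for x y
    unfolding g_def using that bdd by (rule cSUP_upper)
  have "g y \<le> g y' + K * d y y'" if y: "y \<in> M" "y' \<in> M" for y y'
  proof (rule g_le[OF y(1)])
    fix x assume x: "x \<in> M"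
    have "max 0 (d x y' - a) \<le> max 0 (d x y - a) + d y y'"
      using triangle[OF x y] nonneg[of y y'] by linarith
    from mult_left_mono[OF this K(1)] have "u y x \<le> u y' x + K * d y y'"
      by (simp add: u_def algebra_simps)
    then show "u y x \<le> g y' + K * d y y'"
      using u_le[OF x, of y'] by linarith
  qed
  then have g: "(\<lambda>x\<in>M. g x) \<in> cont_funs mtopology"
    by (rule Lipschitz_in_cont_funs)
  have "\<mu> f \<le> \<nu> (\<lambda>x\<in>M. g x)"
  proof (rule closeD[OF \<mu>\<nu> f g])
    fix x y assume "x \<in> M" "y \<in> M" "d x y \<le> a"
    then show "f x \<le> (\<lambda>x\<in>M. g x) y"
      using u_le[of x y] by (simp add: u_def)
  qed
  also have "\<nu> (\<lambda>x\<in>M. g x) \<le> \<kappa> h"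
  proof (rule closeD[OF \<nu>\<kappa> g h])
    fix y z assume y: "y \<in> M" and z: "z \<in> M" and yz: "d y z \<le> b"
    have "g y \<le> h z"
    proof (rule g_le[OF y])
      fix x assume x: "x \<in> M"
      show "u y x \<le> h z"
      proof (cases "d x y \<le> a + e")
        case True
        then have "f x \<le> h z"
          using le x z triangle[OF x y z] yz by auto
        then show ?thesis
          using mult_nonneg_nonneg[OF K(1), of "max 0 (d x y - a)"] by (simp add: u_def)
      next
        case False
        then have "K * e \<le> K * max 0 (d x y - a)"
          using K(1) by (intro mult_left_mono) auto
        then show ?thesis
          using K(2) B[OF x] C[OF z] by (simp add: u_def)
      qed
    qed
    then show "(\<lambda>x\<in>M. g x) y \<le> h z"
      using y by simp
  qed
  finally show "\<mu> f \<le> \<kappa> h" .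
qed

text \<open>Uniform continuity gives \<open>f x \<le> f y + e\<close> for \<open>x\<close> and \<open>y\<close> near enough, so \<open>\<mu> f \<le> \<nu> f + e\<close>.\<close>

lemma close_all_imp_le:
  assumes comp: "compact_space mtopology" and \<mu>: "\<mu> \<in> risk_measures mtopology"
    and \<nu>: "\<nu> \<in> risk_measures mtopology"
    and close: "\<And>r. 0 < r \<Longrightarrow> close r \<mu> \<nu>" and f: "f \<in> cont_funs mtopology"
  shows "\<mu> f \<le> \<nu> f"
proof (rule field_le_epsilon)
  fix e :: real assume e: "e > 0"
  have "uniformly_continuous_map (metric (M, d)) euclidean_metric f"
    using comp cont_funs_continuous[OF f] by (intro continuous_imp_uniformly_continuous_map) simp
  then obtain r where r: "r > 0" "\<And>x y. \<lbrakk>x \<in> M; y \<in> M; d y x < r\<rbrakk> \<Longrightarrow> \<bar>f y - f x\<bar> < e"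
    using e unfolding uniformly_continuous_map_def by (auto simp: dist_real_def)
  have "\<mu> f \<le> \<nu> (\<lambda>x\<in>topspace mtopology. f x + e)"
  proof (rule closeD[OF close f shift_in_cont_funs[OF f]])
    show "0 < r / 2"
      using r by simp
    fix x y assume "x \<in> M" "y \<in> M" "d x y \<le> r / 2"
    then show "f x \<le> (\<lambda>x\<in>topspace mtopology. f x + e) y"
      using r(1) r(2)[of y x] by (auto simp: abs_less_iff)
  qed
  then show "\<mu> f \<le> \<nu> f + e"
    using risk_measure_shift[OF \<nu> f] by simp
qed

text \<open>Closeness is tested on \<open>f = d _ y\<close> and \<open>g = d y _ + r\<close>, which satisfy \<open>f u \<le> g v\<close> for
  \<open>d u v \<le> r\<close> by the triangle inequality.\<close>

lemma dirac_close_iff: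
  assumes "x \<in> M" "y \<in> M" "0 \<le> r"
  shows "close r (dirac_risk mtopology x) (dirac_risk mtopology y) \<longleftrightarrow> d x y \<le> r"
proof
  assume "d x y \<le> r"
  then show "close r (dirac_risk mtopology x) (dirac_risk mtopology y)"
    using assms by (auto simp: close_def dirac_risk_def)
next
  assume close: "close r (dirac_risk mtopology x) (dirac_risk mtopology y)"
  have L: "d u y \<le> d v y + 1 * d u v" "d y u + r \<le> d y v + r + 1 * d u v" if "u \<in> M" "v \<in> M" for u v
    using triangle[of u v y] triangle[of y v u] that assms by (simp_all add: commute)
  have f: "(\<lambda>u\<in>M. d u y) \<in> cont_funs mtopology"
    by (rule Lipschitz_in_cont_funs[OF L(1)])
  have g: "(\<lambda>u\<in>M. d y u + r) \<in> cont_funs mtopology"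
    by (rule Lipschitz_in_cont_funs[OF L(2)])
  have "dirac_risk mtopology x (\<lambda>u\<in>M. d u y) \<le> dirac_risk mtopology y (\<lambda>u\<in>M. d y u + r)"
  proof (rule closeD[OF close f g])
    fix u v assume "u \<in> M" "v \<in> M" "d u v \<le> r"
    then show "(\<lambda>u\<in>M. d u y) u \<le> (\<lambda>u\<in>M. d y u + r) v"
      using triangle[of u v y] assms(2) by (simp add: commute)
  qed
  then show "d x y \<le> r"
    using f g assms by (simp add: dirac_risk_def)
qed

section \<open>Admissible functionals and closeness\<close>

definition cost :: "(('a \<times> 'a \<Rightarrow> real) \<Rightarrow> real) \<Rightarrow> real" where
  "cost \<xi> = (GREATEST r. r \<in> (\<lambda>(x, y). d x y) ` risk_supp (prod_topology mtopology mtopology) \<xi>)"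

lemma continuous_map_dist_prod:
  "continuous_map (prod_topology mtopology mtopology) euclideanreal (\<lambda>(x, y). d x y)"
  using continuous_map_metric[of "metric (M, d)"] by simp

lemma compact_normal_square:
  assumes "compact_space mtopology"
  shows "compact_space (prod_topology mtopology mtopology)"
    "normal_space (prod_topology mtopology mtopology)"
  using assms Hausdorff_space_mtopology
  by (auto simp: compact_space_prod_topology Hausdorff_space_prod_topology
      intro!: compact_Hausdorff_or_regular_imp_normal_space)

lemma cost_attained:
  assumes comp: "compact_space mtopology"
    and \<xi>: "\<xi> \<in> risk_measures (prod_topology mtopology mtopology)"
  shows "cost \<xi> \<in> (\<lambda>(x, y). d x y) ` risk_supp (prod_topology mtopology mtopology) \<xi>"
    and "(x, y) \<in> risk_supp (prod_topology mtopology mtopology) \<xi> \<Longrightarrow> d x y \<le> cost \<xi>"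
proof -
  let ?X2 = "prod_topology mtopology mtopology"
  let ?D = "(\<lambda>(x, y). d x y) ` risk_supp ?X2 \<xi>"
  note X2 = compact_normal_square[OF comp]
  have "compactin ?X2 (risk_supp ?X2 \<xi>)"
    using closedin_compact_space[OF X2(1) closedin_risk_supp[OF \<xi>]] .
  then have "compact ?D"
    using image_compactin[OF _ continuous_map_dist_prod] by simp
  moreover have "?D \<noteq> {}"
    using risk_supp_nonempty[OF X2 \<xi>] by simp
  ultimately obtain m where m: "m \<in> ?D" "\<forall>r\<in>?D. r \<le> m"
    using compact_attains_sup by blast
  then have "cost \<xi> = m"
    unfolding cost_def by (intro Greatest_equality) auto
  then show "cost \<xi> \<in> ?D" "(x, y) \<in> risk_supp ?X2 \<xi> \<Longrightarrow> d x y \<le> cost \<xi>"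
    using m by auto
qed

lemma cost_nonneg:
  assumes "compact_space mtopology" "\<xi> \<in> risk_measures (prod_topology mtopology mtopology)"
  shows "0 \<le> cost \<xi>"
  using cost_attained(1)[OF assms] by auto

text \<open>An inequality \<open>f x \<le> g y\<close> that holds for \<open>d x y \<le> cost \<xi>\<close> holds on the support of \<open>\<xi>\<close>, hence
  after applying \<open>\<xi>\<close> to both sides, and this gives the marginals.\<close>

lemma admissible_imp_close:
  assumes comp: "compact_space mtopology" and \<xi>: "\<xi> \<in> admissible mtopology \<mu> \<nu>"
  shows "close (cost \<xi>) \<mu> \<nu>" "close (cost \<xi>) \<nu> \<mu>"
proof -
  let ?X2 = "prod_topology mtopology mtopology"
  have \<xi>2: "\<xi> \<in> risk_measures ?X2" and \<mu>: "\<mu> = push_risk ?X2 mtopology fst \<xi>"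
    and \<nu>: "\<nu> = push_risk ?X2 mtopology snd \<xi>"
    using \<xi> by (auto simp: admissible_def)
  note ord = ordered_on_risk_supp[OF compact_normal_square[OF comp] \<xi>2]
  have supp: "risk_supp ?X2 \<xi> \<subseteq> M \<times> M"
    using closedin_subset[OF closedin_risk_supp[OF \<xi>2]] by simp
  have pt: "compose (topspace ?X2) f fst (x, y) = f x" "compose (topspace ?X2) f snd (x, y) = f y"
    "x \<in> M" "y \<in> M" "d x y \<le> cost \<xi>"
    if "(x, y) \<in> risk_supp ?X2 \<xi>" for f :: "'a \<Rightarrow> real" and x y
    using that supp cost_attained(2)[OF comp \<xi>2 that] by (auto simp: compose_eq)
  note cont = compose_in_cont_funs[OF continuous_map_fst] compose_in_cont_funs[OF continuous_map_snd]
  show "close (cost \<xi>) \<mu> \<nu>" "close (cost \<xi>) \<nu> \<mu>"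
    unfolding close_def \<mu> \<nu> push_risk_def
    by (auto intro!: ordered_onD[OF ord] simp: cont pt commute simp del: topspace_prod_topology)
qed

text \<open>Couple \<open>\<mu>\<close> and \<open>\<nu>\<close> on the compact set \<open>{d \<le> r}\<close>, which projects onto both factors because it
  contains the diagonal, and push the coupling forward to the square.\<close>

lemma close_imp_admissible:
  assumes comp: "compact_space mtopology" and \<mu>: "\<mu> \<in> risk_measures mtopology"
    and \<nu>: "\<nu> \<in> risk_measures mtopology"
    and r: "0 \<le> r" "close r \<mu> \<nu>" "close r \<nu> \<mu>"
  obtains \<xi> where "\<xi> \<in> admissible mtopology \<mu> \<nu>" "cost \<xi> \<le> r"
proof -
  let ?X2 = "prod_topology mtopology mtopology"
  define R where "R = {z \<in> topspace ?X2. (case z of (x, y) \<Rightarrow> d x y) \<in> {..r}}"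
  define Z where "Z = subtopology ?X2 R"
  have R: "closedin ?X2 R"
    unfolding R_def by (rule closedin_continuous_map_preimage[OF continuous_map_dist_prod]) auto
  have top: "topspace Z = {(x, y). x \<in> M \<and> y \<in> M \<and> d x y \<le> r}"
    by (auto simp: Z_def R_def)
  have Z: "compact_space Z"
    unfolding Z_def
    using closedin_compact_space[OF compact_normal_square(1)[OF comp] R] by (simp add: compact_space_subtopology)
  have pr: "continuous_map Z mtopology fst" "continuous_map Z mtopology snd"
    unfolding Z_def by (intro continuous_map_from_subtopology continuous_map_fst continuous_map_snd)+
  have diag: "(x, x) \<in> topspace Z" if "x \<in> M" for x
    using that r(1) by (simp add: top)
  have onto: "fst ` topspace Z = topspace mtopology" "snd ` topspace Z = topspace mtopology"
  proof -
    show "fst ` topspace Z = topspace mtopology"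
      using image_eqI[OF _ diag, of _ fst] by (fastforce simp: top)
    show "snd ` topspace Z = topspace mtopology"
      using image_eqI[OF _ diag, of _ snd] by (fastforce simp: top)
  qed
  obtain \<zeta> where \<zeta>: "\<zeta> \<in> risk_measures Z" "push_risk Z mtopology fst \<zeta> = \<mu>" "push_risk Z mtopology snd \<zeta> = \<nu>"
  proof (rule coupling_exists[OF Z pr(1) onto(1) pr(2) onto(2) \<mu> \<nu>])
    show "\<mu> f \<le> \<nu> g" if "f \<in> cont_funs mtopology" "g \<in> cont_funs mtopology"
      "\<And>z. z \<in> topspace Z \<Longrightarrow> f (fst z) \<le> g (snd z)" for f g
      using that(3)[of "(_, _)"] by (intro closeD[OF r(2) that(1,2)]) (simp add: top)
    show "\<nu> g \<le> \<mu> f" if "f \<in> cont_funs mtopology" "g \<in> cont_funs mtopology"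
      "\<And>z. z \<in> topspace Z \<Longrightarrow> g (snd z) \<le> f (fst z)" for f g
      using that(3)[of "(_, _)"] by (intro closeD[OF r(3) that(2,1)]) (simp add: top commute)
  qed blast
  have id: "continuous_map Z ?X2 (\<lambda>z. z)"
    by (simp add: Z_def)
  define \<xi> where "\<xi> = push_risk Z ?X2 (\<lambda>z. z) \<zeta>"
  have \<xi>: "\<xi> \<in> risk_measures ?X2"
    unfolding \<xi>_def by (rule push_risk_in_risk_measures[OF id \<zeta>(1)])
  have "\<xi> \<in> admissible mtopology \<mu> \<nu>"
    using \<xi> \<zeta>(2,3) unfolding admissible_def \<xi>_def
    by (simp add: push_risk_push_risk[OF id] continuous_map_fst continuous_map_snd)
  moreover have "risk_supp ?X2 \<xi> \<subseteq> R"
    unfolding risk_supp_def using R \<zeta>(1)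
    by (intro Inter_lower) (auto simp: concentrated_on_def \<xi>_def Z_def)
  then have "cost \<xi> \<le> r"
    using cost_attained(1)[OF comp \<xi>] by (auto simp: R_def)
  ultimately show thesis
    using that by blast
qed

text \<open>For \<open>r\<close> at least the diameter, closeness is automatic: the hypothesis becomes \<open>f x \<le> g y\<close> for
  all \<open>x\<close> and \<open>y\<close>, and the constant \<open>sup f\<close> lies between \<open>f\<close> and \<open>g\<close>.\<close>

lemma admissible_nonempty:
  assumes comp: "compact_space mtopology" and \<mu>: "\<mu> \<in> risk_measures mtopology"
    and \<nu>: "\<nu> \<in> risk_measures mtopology"
  shows "admissible mtopology \<mu> \<nu> \<noteq> {}"
proof -
  have "compact ((\<lambda>(x, y). d x y) ` topspace (prod_topology mtopology mtopology))"
    using image_compactin[OF _ continuous_map_dist_prod] compact_normal_square(1)[OF comp]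
    unfolding compact_space_def by simp
  then obtain D where D: "\<And>x y. \<lbrakk>x \<in> M; y \<in> M\<rbrakk> \<Longrightarrow> d x y \<le> D"
    by (force dest!: compact_imp_bounded simp: bounded_iff)
  \<comment> \<open>For empty \<open>M\<close> the bound \<open>D\<close> can be negative, but a closeness radius must not be.\<close>
  have close: "close \<bar>D\<bar> \<mu> \<nu>" if \<mu>: "\<mu> \<in> risk_measures mtopology" and \<nu>: "\<nu> \<in> risk_measures mtopology" for \<mu> \<nu>
    unfolding close_def
  proof (intro ballI impI)
    fix f g
    assume f: "f \<in> cont_funs mtopology" and g: "g \<in> cont_funs mtopology"
      and le: "\<forall>x\<in>M. \<forall>y\<in>M. d x y \<le> \<bar>D\<bar> \<longrightarrow> f x \<le> g y"
    have fg: "f x \<le> g y" if "x \<in> M" "y \<in> M" for x y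
      using le D[OF that] that by auto
    obtain B where B: "\<And>x. x \<in> M \<Longrightarrow> \<bar>f x\<bar> \<le> B"
      using cont_funs_bounded[OF comp f] by auto
    define c where "c = (SUP x\<in>M. f x)"
    have bdd: "bdd_above (f ` M)"
      using B by (force intro: bdd_aboveI2 simp: abs_le_iff)
    have "\<mu> f \<le> \<mu> (\<lambda>x\<in>topspace mtopology. c)"
      using bdd by (intro risk_measure_mono[OF \<mu> f const_in_cont_funs]) (auto simp: c_def intro: cSUP_upper)
    also have "\<dots> = \<nu> (\<lambda>x\<in>topspace mtopology. c)"
      by (simp only: risk_measure_const[OF \<mu>] risk_measure_const[OF \<nu>])
    also have "\<dots> \<le> \<nu> g"
      using fg by (intro risk_measure_mono[OF \<nu> const_in_cont_funs g]) (auto simp: c_def intro: cSUP_least)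
    finally show "\<mu> f \<le> \<nu> g" .
  qed
  show ?thesis
    using close_imp_admissible[OF comp \<mu> \<nu> abs_ge_zero close[OF \<mu> \<nu>] close[OF \<nu> \<mu>]] by blast
qed

section \<open>The metric on risk measures\<close>

lemma risk_dist_eq_INF_cost:
  assumes "\<mu> \<in> risk_measures mtopology" "\<nu> \<in> risk_measures mtopology"
  shows "risk_dist M d \<mu> \<nu> = (INF \<xi>\<in>admissible mtopology \<mu> \<nu>. cost \<xi>)"
  using assms by (simp add: risk_dist_def cost_def Let_def)

lemma risk_dist_nonneg:
  assumes "compact_space mtopology"
  shows "0 \<le> risk_dist M d \<mu> \<nu>"
proof (cases "\<mu> \<in> risk_measures mtopology \<and> \<nu> \<in> risk_measures mtopology")
  case True
  then show ?thesis
    using admissible_nonempty[OF assms] cost_nonneg[OF assms]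
    by (auto simp: risk_dist_eq_INF_cost admissible_def intro!: cINF_greatest)
next
  case False
  then show ?thesis
    by (auto simp: risk_dist_def)
qed

lemma risk_dist_le:
  assumes comp: "compact_space mtopology" and \<mu>: "\<mu> \<in> risk_measures mtopology"
    and \<nu>: "\<nu> \<in> risk_measures mtopology"
    and r: "0 \<le> r" "close r \<mu> \<nu>" "close r \<nu> \<mu>"
  shows "risk_dist M d \<mu> \<nu> \<le> r"
proof -
  obtain \<xi> where \<xi>: "\<xi> \<in> admissible mtopology \<mu> \<nu>" "cost \<xi> \<le> r"
    using close_imp_admissible[OF assms] .
  have "bdd_below (cost ` admissible mtopology \<mu> \<nu>)"
    using cost_nonneg[OF comp] by (intro bdd_belowI2[of _ 0]) (auto simp: admissible_def)
  then show ?thesis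
    unfolding risk_dist_eq_INF_cost[OF \<mu> \<nu>] using \<xi> by (intro cINF_lower2)
qed

lemma risk_dist_less_imp_close:
  assumes comp: "compact_space mtopology" and \<mu>: "\<mu> \<in> risk_measures mtopology"
    and \<nu>: "\<nu> \<in> risk_measures mtopology" and r: "risk_dist M d \<mu> \<nu> < r"
  shows "close r \<mu> \<nu>" "close r \<nu> \<mu>"
proof -
  obtain \<xi> where "\<xi> \<in> admissible mtopology \<mu> \<nu>" "cost \<xi> < r"
    using cInf_lessD[OF _ r[unfolded risk_dist_eq_INF_cost[OF \<mu> \<nu>]]] admissible_nonempty[OF comp \<mu> \<nu>] by auto
  then show "close r \<mu> \<nu>" "close r \<nu> \<mu>"
    using admissible_imp_close[OF comp] close_mono[of "cost \<xi>" _ _ r] by auto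
qed

lemma risk_dist_commute:
  assumes "compact_space mtopology"
  shows "risk_dist M d \<mu> \<nu> = risk_dist M d \<nu> \<mu>"
proof (cases "\<mu> \<in> risk_measures mtopology \<and> \<nu> \<in> risk_measures mtopology")
  case True
  have "risk_dist M d \<mu> \<nu> \<le> risk_dist M d \<nu> \<mu>"
    if \<mu>: "\<mu> \<in> risk_measures mtopology" and \<nu>: "\<nu> \<in> risk_measures mtopology" for \<mu> \<nu>
  proof (rule dense_ge)
    fix r assume "risk_dist M d \<nu> \<mu> < r"
    then show "risk_dist M d \<mu> \<nu> \<le> r"
      using risk_dist_less_imp_close[OF assms \<nu> \<mu>] risk_dist_nonneg[OF assms, of \<nu> \<mu>]
      by (intro risk_dist_le[OF assms \<mu> \<nu>]) auto
  qed
  then show ?thesis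
    using True by (simp add: order_antisym)
next
  case False
  then show ?thesis
    by (auto simp: risk_dist_def)
qed

lemma risk_dist_eq_0_iff:
  assumes comp: "compact_space mtopology" and \<mu>: "\<mu> \<in> risk_measures mtopology"
    and \<nu>: "\<nu> \<in> risk_measures mtopology"
  shows "risk_dist M d \<mu> \<nu> = 0 \<longleftrightarrow> \<mu> = \<nu>"
proof
  assume "risk_dist M d \<mu> \<nu> = 0"
  then have "close r \<mu> \<nu>" "close r \<nu> \<mu>" if "0 < r" for r
    using risk_dist_less_imp_close[OF assms] that by auto
  then show "\<mu> = \<nu>"
    by (intro risk_measure_eqI[OF \<mu> \<nu>] order_antisym close_all_imp_le[OF comp] \<mu> \<nu>)
next
  assume "\<mu> = \<nu>"
  then show "risk_dist M d \<mu> \<nu> = 0"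
    using risk_dist_le[OF assms order_refl] close_refl[OF \<mu>, of 0] risk_dist_nonneg[OF comp, of \<mu> \<nu>]
    by (simp add: order_antisym)
qed

lemma risk_dist_triangle:
  assumes comp: "compact_space mtopology" and \<mu>: "\<mu> \<in> risk_measures mtopology"
    and \<nu>: "\<nu> \<in> risk_measures mtopology" and \<kappa>: "\<kappa> \<in> risk_measures mtopology"
  shows "risk_dist M d \<mu> \<kappa> \<le> risk_dist M d \<mu> \<nu> + risk_dist M d \<nu> \<kappa>"
proof (rule field_le_epsilon)
  fix e :: real assume "e > 0"
  then have e: "e / 3 > 0"
    by simp
  define a where "a = risk_dist M d \<mu> \<nu> + e / 3"
  define b where "b = risk_dist M d \<nu> \<kappa> + e / 3"
  have ab: "0 \<le> a" "0 \<le> b"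
    using e risk_dist_nonneg[OF comp] by (auto simp: a_def b_def intro: add_nonneg_nonneg)
  have a: "close a \<mu> \<nu>" "close a \<nu> \<mu>"
    using risk_dist_less_imp_close[OF comp \<mu> \<nu>, of a] e by (auto simp: a_def)
  have b: "close b \<nu> \<kappa>" "close b \<kappa> \<nu>"
    using risk_dist_less_imp_close[OF comp \<nu> \<kappa>, of b] e by (auto simp: b_def)
  have "close (a + b + e / 3) \<mu> \<kappa>"
    using close_trans[OF comp ab e a(1) b(1)] .
  moreover have "close (a + b + e / 3) \<kappa> \<mu>"
    using close_trans[OF comp ab(2,1) e b(2) a(2)] by (simp add: add.commute)
  ultimately have "risk_dist M d \<mu> \<kappa> \<le> a + b + e / 3"
    using ab e by (intro risk_dist_le[OF comp \<mu> \<kappa>]) auto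
  then show "risk_dist M d \<mu> \<kappa> \<le> risk_dist M d \<mu> \<nu> + risk_dist M d \<nu> \<kappa> + e"
    by (simp add: a_def b_def)
qed

lemma risk_dist_dirac:
  assumes comp: "compact_space mtopology" and xy: "x \<in> M" "y \<in> M"
  shows "risk_dist M d (dirac_risk mtopology x) (dirac_risk mtopology y) = d x y"
proof (rule order_antisym)
  have \<delta>: "dirac_risk mtopology x \<in> risk_measures mtopology" "dirac_risk mtopology y \<in> risk_measures mtopology"
    using xy by (auto intro: dirac_risk_in_risk_measures)
  show "risk_dist M d (dirac_risk mtopology x) (dirac_risk mtopology y) \<le> d x y"
    using xy by (intro risk_dist_le[OF comp \<delta>]) (auto simp: dirac_close_iff commute)
  show "d x y \<le> risk_dist M d (dirac_risk mtopology x) (dirac_risk mtopology y)"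
  proof (rule dense_ge)
    fix r assume r: "risk_dist M d (dirac_risk mtopology x) (dirac_risk mtopology y) < r"
    then have "0 \<le> r"
      using risk_dist_nonneg[OF comp] by (meson less_imp_le order_trans)
    then show "d x y \<le> r"
      using risk_dist_less_imp_close(1)[OF comp \<delta> r] dirac_close_iff[OF xy] by blast
  qed
qed

end

theorem theorem3p1:
  fixes M :: "'a set" and d :: "'a \<Rightarrow> 'a \<Rightarrow> real"
  assumes "Metric_space M d"
    and "compact_space (Metric_space.mtopology M d)"
  shows "Metric_space (risk_measures (Metric_space.mtopology M d)) (risk_dist M d) \<and>
    (\<forall>x\<in>M. \<forall>y\<in>M.
       risk_dist M d (dirac_risk (Metric_space.mtopology M d) x)
                     (dirac_risk (Metric_space.mtopology M d) y) = d x y)"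
proof -
  interpret Metric_space M d
    by (rule assms)
  note comp = assms(2)
  have "Metric_space (risk_measures mtopology) (risk_dist M d)"
    by (intro Metric_space.intro risk_dist_nonneg risk_dist_commute risk_dist_eq_0_iff
        risk_dist_triangle comp)
  then show ?thesis
    using risk_dist_dirac[OF comp] by blast
qed

end
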